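(* Let $p,q$ be nonzero elements of $D$. Then the matrix $\begin{pmatrix} p & q\\ 0 & 0\end{pmatrix}$ is a product of idempotent $2\times 2$ matrices over $D$ if one of the following holds: (i) $\deg p\ge\deg q$, and either $q(u)>0$ for every real root $u$ of $p$, or $q(u)<0$ for every real root $u$ of $p$; (ii) $\deg q\ge\deg p$, and either $p(z)>0$ for every real root $z$ of $q$, or $p(z)<0$ for every real root $z$ of $q$.
   Context: $D$ denotes the minimal Dress ring of the field $\mathbb{R}(X)$, i.e. the subring of $\mathbb{R}(X)$ generated by $\mathbb{Z}$ and all elements $1/(1+h^2)$ with $h\in\mathbb{R}(X)$; its elements are the rational functions $f/\gamma$ with $f,\gamma\in\mathbb{R}[X]$, $\gamma$ without real roots and $\deg f\le\deg\gamma$. For a rational function $f/g$ ($f,g\in\mathbb{R}[X]$) its degree is $\deg(f/g)=\deg f-\deg g$, and its real roots are the real numbers where it vanishes (for elements of $D$, the real roots of the numerator in reduced form). A matrix $E$ is idempotent if $E^2=E$. *)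

theory Defs
  imports "HOL-Analysis.Analysis" "HOL-Computational_Algebra.Polynomial"
    "HOL-Computational_Algebra.Fraction_Field" "HOL-Computational_Algebra.Normalized_Fraction"
    "HOL-Computational_Algebra.Polynomial_Factorial" "HOL-Computational_Algebra.Field_as_Ring"
begin

text \<open>The field R(X) is rendered as \<open>real poly fract\<close>.
  The minimal Dress ring D: rational functions f/g with g without real roots and deg f \<le> deg g.\<close>
definition dressD :: "real poly fract set" where
  "dressD = {x. \<exists>f g. g \<noteq> 0 \<and> (\<forall>u::real. poly g u \<noteq> 0) \<and> degree f \<le> degree g \<and> x = Fract f g}"

text \<open>Numerator and denominator of the reduced form.\<close>
definition rnum :: "real poly fract \<Rightarrow> real poly" where
  "rnum x = fst (quot_of_fract x)"
definition rden :: "real poly fract \<Rightarrow> real poly" where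
  "rden x = snd (quot_of_fract x)"

text \<open>Degree of a rational function f/g: deg f - deg g.\<close>
definition rdeg :: "real poly fract \<Rightarrow> int" where
  "rdeg x = int (degree (rnum x)) - int (degree (rden x))"

text \<open>Value of a rational function at a real point.\<close>
definition reval :: "real poly fract \<Rightarrow> real \<Rightarrow> real" where
  "reval x u = poly (rnum x) u / poly (rden x) u"

text \<open>Real roots: real zeros of the numerator in reduced form.\<close>
definition rroots :: "real poly fract \<Rightarrow> real set" where
  "rroots x = {u. poly (rnum x) u = 0}"

definition idempotent_mat :: "'a::semiring_1 ^'n::finite^'n \<Rightarrow> bool" where
  "idempotent_mat E \<longleftrightarrow> E ** E = E"

text \<open>A 2x2 matrix over D is a (finite) product of idempotent 2x2 matrices over D.\<close>
definition prod_idempotents_D :: "real poly fract ^2^2 \<Rightarrow> bool" where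
  "prod_idempotents_D M \<longleftrightarrow> (\<exists>Es. (\<forall>E\<in>set Es. (\<forall>i j. E $ i $ j \<in> dressD) \<and> idempotent_mat E)
      \<and> M = foldr (**) Es (mat 1))"

definition row_mat :: "'a::zero \<Rightarrow> 'a \<Rightarrow> 'a ^2^2" where
  "row_mat p q = (\<chi> i j. if i = 1 then (if j = 1 then p else q) else 0)"

end

theory Submission
  imports Defs "HOL-Computational_Algebra.Fundamental_Theorem_Algebra"
begin

text \<open>If \<open>e\<close> is a unit of \<open>D\<close> and \<open>v p + e q = 1\<close> with \<open>v p, v q \<in> D\<close>, the rank one matrix
  \<open>(v, e)\<^sup>T (p, q)\<close> is idempotent, and \<open>row_mat p q\<close> is obtained from it by multiplying
  on the left by the idempotents \<open>row_mat 1 (1/e)\<close> and \<open>diag(0, 1)\<close>; the second case is symmetric,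
  with one more factor. Taking \<open>v = (1 - q e) / p\<close>, everything reduces to finding a unit \<open>e\<close>
  of \<open>D\<close> with \<open>q (1 - q e) / p \<in> D\<close>.

  Write \<open>p = f/g\<close>, \<open>q = h/k\<close> in lowest terms and \<open>f = r fc\<close>, where \<open>r\<close> is the product of
  the linear factors of \<open>f\<close> at its real roots. As \<open>h\<close> does not vanish there, \<open>k \<equiv> h L (mod r)\<close> is
  solvable, and \<open>L = k/h\<close> has the constant sign \<open>s\<close> of \<open>q\<close> at the roots of \<open>r\<close>. Adding a large
  multiple of \<open>r\<^sup>2 (1 + X\<^sup>2)\<^sup>m\<close> makes \<open>s L\<close> positive everywhere; this yields polynomials \<open>A \<equiv> L\<close>,
  \<open>B \<equiv> 1 (mod r)\<close> without real roots and of equal degree. For \<open>e = A/B\<close>, \<open>r\<close> divides \<open>k B - h A\<close>,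
  which cancels the real poles of \<open>q (1 - q e) / p\<close>, and \<open>deg q \<le> deg p\<close> bounds its degree.\<close>

lemma Fract_in_dressD:
  assumes "\<forall>u. poly g u \<noteq> 0" and "degree f \<le> degree g"
  shows "Fract f g \<in> dressD"
proof -
  have "g \<noteq> 0" using assms(1) by auto
  then show ?thesis using assms unfolding dressD_def by blast
qed

lemma dressD_E:
  assumes "x \<in> dressD"
  obtains f g where "\<forall>u. poly g u \<noteq> 0" "degree f \<le> degree g" "x = Fract f g"
  using assms unfolding dressD_def by blast

lemma zero_in_dressD: "0 \<in> dressD"
  using Fract_in_dressD[of 1 0] by (simp add: Zero_fract_def)

lemma one_in_dressD: "1 \<in> dressD"
  using Fract_in_dressD[of 1 1] by (simp add: One_fract_def)

lemma dressD_add: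
  assumes "x \<in> dressD" "y \<in> dressD"
  shows "x + y \<in> dressD"
proof -
  obtain f g where x: "\<forall>u. poly g u \<noteq> 0" "degree f \<le> degree g" "x = Fract f g"
    using assms(1) by (rule dressD_E)
  obtain f' g' where y: "\<forall>u. poly g' u \<noteq> 0" "degree f' \<le> degree g'" "y = Fract f' g'"
    using assms(2) by (rule dressD_E)
  have "g \<noteq> 0" "g' \<noteq> 0" using x(1) y(1) by auto
  then have sum: "x + y = Fract (f * g' + f' * g) (g * g')"
    and deg: "degree (g * g') = degree g + degree g'"
    using x(3) y(3) by (simp_all add: degree_mult_eq)
  have "degree (f * g' + f' * g) \<le> degree (g * g')"
    using degree_add_le[of "f * g'" _ "f' * g"] degree_mult_le[of f g'] degree_mult_le[of f' g]
      x(2) y(2) deg by fastforce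
  then show ?thesis unfolding sum using x(1) y(1) by (intro Fract_in_dressD) auto
qed

lemma dressD_mult:
  assumes "x \<in> dressD" "y \<in> dressD"
  shows "x * y \<in> dressD"
proof -
  obtain f g where x: "\<forall>u. poly g u \<noteq> 0" "degree f \<le> degree g" "x = Fract f g"
    using assms(1) by (rule dressD_E)
  obtain f' g' where y: "\<forall>u. poly g' u \<noteq> 0" "degree f' \<le> degree g'" "y = Fract f' g'"
    using assms(2) by (rule dressD_E)
  have "g \<noteq> 0" "g' \<noteq> 0" using x(1) y(1) by auto
  then have "degree (f * f') \<le> degree (g * g')"
    using degree_mult_le[of f f'] x(2) y(2) by (simp add: degree_mult_eq)
  moreover have "x * y = Fract (f * f') (g * g')" using x(3) y(3) by simp
  ultimately show ?thesis using x(1) y(1) by (simp add: Fract_in_dressD)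
qed

lemma dressD_uminus:
  assumes "x \<in> dressD"
  shows "- x \<in> dressD"
proof -
  obtain f g where x: "\<forall>u. poly g u \<noteq> 0" "degree f \<le> degree g" "x = Fract f g"
    using assms by (rule dressD_E)
  then show ?thesis by (simp add: Fract_in_dressD)
qed

lemma dressD_diff: "x \<in> dressD \<Longrightarrow> y \<in> dressD \<Longrightarrow> x - y \<in> dressD"
  using dressD_add[of x "- y"] dressD_uminus[of y] by simp

lemma dressD_reduced:
  assumes "x \<in> dressD"
  shows "\<forall>u. poly (rden x) u \<noteq> 0" and "degree (rnum x) \<le> degree (rden x)"
    and "x = Fract (rnum x) (rden x)"
proof -
  obtain f g where x: "\<forall>u. poly g u \<noteq> 0" "degree f \<le> degree g" "x = Fract f g"
    using assms by (rule dressD_E)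
  show x_eq: "x = Fract (rnum x) (rden x)" unfolding rnum_def rden_def by simp
  have "g \<noteq> 0" "rden x \<noteq> 0" using x(1) by (auto simp: rden_def)
  then have cross: "rnum x * g = f * rden x" using x(3) x_eq by (metis eq_fract(1))
  have "coprime (rden x) (rnum x)"
    unfolding rnum_def rden_def using coprime_quot_of_fract by (simp add: coprime_commute)
  then have "rden x dvd g"
    using cross by (metis coprime_dvd_mult_right_iff dvd_triv_right)
  then obtain w where "g = rden x * w" by (rule dvdE)
  then show "\<forall>u. poly (rden x) u \<noteq> 0" using x(1) by auto
  show "degree (rnum x) \<le> degree (rden x)"
  proof (cases "rnum x = 0")
    case False
    then have "f \<noteq> 0" using cross \<open>g \<noteq> 0\<close> by auto
    then have "degree (rnum x) + degree g = degree f + degree (rden x)"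
      using cross False \<open>g \<noteq> 0\<close> \<open>rden x \<noteq> 0\<close> by (metis degree_mult_eq)
    then show ?thesis using x(2) by linarith
  qed simp
qed

definition row2_mat :: "'a::zero \<Rightarrow> 'a \<Rightarrow> 'a ^2^2" where
  "row2_mat a b = (\<chi> i j. if i = 2 then (if j = 1 then a else b) else 0)"

definition col_row_mat :: "'a::times \<Rightarrow> 'a \<Rightarrow> 'a \<Rightarrow> 'a \<Rightarrow> 'a ^2^2" where
  "col_row_mat a b p q = (\<chi> i j. (if i = 1 then a else b) * (if j = 1 then p else q))"

lemmas mat2_simps = matrix_matrix_mult_def vec_eq_iff forall_2 sum_2 row_mat_def row2_mat_def
  col_row_mat_def mat_def

lemma idempotent_row_mat: "idempotent_mat (row_mat (1::'a::semiring_1) b)"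
  by (simp add: idempotent_mat_def mat2_simps)

lemma idempotent_row2_mat: "idempotent_mat (row2_mat a (1::'a::semiring_1))"
  by (simp add: idempotent_mat_def mat2_simps)

lemma idempotent_col_row_mat:
  fixes a b p q :: "'a::comm_ring_1"
  assumes "a * p + b * q = 1"
  shows "idempotent_mat (col_row_mat a b p q)"
proof -
  have "col_row_mat a b p q ** col_row_mat a b p q
      = (\<chi> i j. (a * p + b * q) * col_row_mat a b p q $ i $ j)"
    by (simp add: mat2_simps algebra_simps)
  then show ?thesis using assms by (simp add: idempotent_mat_def vec_eq_iff)
qed

lemma row_mat_factorization_left:
  fixes e v p q :: "'a::field"
  assumes "e \<noteq> 0"
  shows "row_mat p q = foldr (**) [row_mat 1 (1 / e), row2_mat 0 1, col_row_mat v e p q] (mat 1)"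
  using assms by (simp add: mat2_simps)

lemma row_mat_factorization_right:
  fixes e v p q :: "'a::field"
  assumes "e \<noteq> 0"
  shows "row_mat p q
    = foldr (**) [row_mat 1 1, row2_mat (1 / e) 1, row_mat 1 0, col_row_mat e v p q] (mat 1)"
  using assms by (simp add: mat2_simps)

lemma prod_idempotents_DI:
  assumes "\<And>E. E \<in> set Es \<Longrightarrow> (\<forall>i j. E $ i $ j \<in> dressD) \<and> idempotent_mat E"
  shows "prod_idempotents_D (foldr (**) Es (mat 1))"
  using assms unfolding prod_idempotents_D_def by blast

lemma prod_idempotents_D_row_matI_left:
  assumes "p \<in> dressD" "q \<in> dressD" "p \<noteq> 0"
    and "e \<noteq> 0" "e \<in> dressD" "1 / e \<in> dressD" "q * (1 - q * e) / p \<in> dressD"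
  shows "prod_idempotents_D (row_mat p q)"
proof -
  define v where "v = (1 - q * e) / p"
  have "v * p + e * q = 1" using \<open>p \<noteq> 0\<close> by (simp add: v_def)
  moreover have "v * p \<in> dressD" "v * q \<in> dressD"
    using assms \<open>p \<noteq> 0\<close> by (simp_all add: v_def dressD_diff dressD_mult one_in_dressD mult.commute)
  ultimately have "\<forall>E\<in>set [row_mat 1 (1 / e), row2_mat 0 1, col_row_mat v e p q].
      (\<forall>i j. E $ i $ j \<in> dressD) \<and> idempotent_mat E"
    using assms
    by (simp add: idempotent_row_mat idempotent_row2_mat idempotent_col_row_mat)
      (auto simp: row_mat_def row2_mat_def col_row_mat_def forall_2 zero_in_dressD one_in_dressD
        dressD_mult mult.commute[of e])
  then show ?thesis
    unfolding row_mat_factorization_left[OF \<open>e \<noteq> 0\<close>, of p q v]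
    by (blast intro: prod_idempotents_DI)
qed

lemma prod_idempotents_D_row_matI_right:
  assumes "p \<in> dressD" "q \<in> dressD" "q \<noteq> 0"
    and "e \<noteq> 0" "e \<in> dressD" "1 / e \<in> dressD" "p * (1 - p * e) / q \<in> dressD"
  shows "prod_idempotents_D (row_mat p q)"
proof -
  define v where "v = (1 - p * e) / q"
  have "e * p + v * q = 1" using \<open>q \<noteq> 0\<close> by (simp add: v_def)
  moreover have "v * q \<in> dressD" "v * p \<in> dressD"
    using assms \<open>q \<noteq> 0\<close> by (simp_all add: v_def dressD_diff dressD_mult one_in_dressD mult.commute)
  ultimately have "\<forall>E\<in>set [row_mat 1 1, row2_mat (1 / e) 1, row_mat 1 0, col_row_mat e v p q].
      (\<forall>i j. E $ i $ j \<in> dressD) \<and> idempotent_mat E"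
    using assms
    by (simp add: idempotent_row_mat idempotent_row2_mat idempotent_col_row_mat)
      (auto simp: row_mat_def row2_mat_def col_row_mat_def forall_2 zero_in_dressD one_in_dressD
        dressD_mult mult.commute[of e])
  then show ?thesis
    unfolding row_mat_factorization_right[OF \<open>e \<noteq> 0\<close>, of p q v]
    by (blast intro: prod_idempotents_DI)
qed

lemma real_poly_split_real_roots:
  fixes f :: "real poly"
  assumes "f \<noteq> 0"
  obtains us fc where "f = (\<Prod>u\<leftarrow>us. [:-u, 1:]) * fc" and "\<forall>x. poly fc x \<noteq> 0"
  using assms
proof (induction "degree f" arbitrary: f thesis rule: less_induct)
  case less
  show ?case
  proof (cases "\<exists>u. poly f u = 0")
    case False
    then show ?thesis using less.prems(1)[of "[]" f] by auto
  next
    case True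
    then obtain u where "[:-u, 1:] dvd f" by (auto simp: poly_eq_0_iff_dvd)
    then obtain f' where f: "f = [:-u, 1:] * f'" by (rule dvdE)
    with less.prems(2) have "f' \<noteq> 0" by auto
    then have "degree f' < degree f"
      unfolding f by (subst degree_mult_eq) auto
    then obtain us fc where f': "f' = (\<Prod>u\<leftarrow>us. [:-u, 1:]) * fc" "\<forall>x. poly fc x \<noteq> 0"
      using less.hyps \<open>f' \<noteq> 0\<close> by blast
    have "f = (\<Prod>u\<leftarrow>u # us. [:-u, 1:]) * fc"
      using f f'(1) by (simp only: list.map prod_list.Cons mult.assoc)
    then show ?thesis using less.prems(1) f'(2) by blast
  qed
qed

lemma coprime_linear_factors:
  fixes h :: "real poly"
  assumes "\<forall>u\<in>set us. poly h u \<noteq> 0"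
  shows "coprime h (\<Prod>u\<leftarrow>us. [:-u, 1:])"
proof (rule prod_list_coprime_right)
  fix d assume "d \<in> set (map (\<lambda>u. [:-u, 1:]) us)"
  then obtain u where "u \<in> set us" "d = [:-u, 1:]" by auto
  then show "coprime h d"
    using assms prime_elem_imp_coprime[OF prime_elem_linear_field_poly, of 1 "-u" h]
    by (simp add: poly_eq_0_iff_dvd coprime_commute)
qed

lemma coprime_solve_congruence:
  fixes h m :: "'a::euclidean_ring_gcd"
  assumes "coprime h m"
  obtains L where "m dvd k - h * L"
proof -
  define x y where "x = fst (bezout_coefficients h m)" and "y = snd (bezout_coefficients h m)"
  have "x * h + y * m = 1"
    using bezout_coefficients_fst_snd[of h m] assms by (simp add: x_def y_def)
  then have "k - h * (k * x) = k * (x * h + y * m) - h * (k * x)" by simp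
  also have "\<dots> = k * (y * m)" by (simp add: algebra_simps)
  finally show ?thesis using that[of "k * x"] by (simp add: mult_ac)
qed

lemma abs_poly_le_sum_abs_coeff:
  fixes L :: "real poly"
  assumes "degree L \<le> m"
  shows "\<bar>poly L x\<bar> \<le> (\<Sum>i\<le>degree L. \<bar>coeff L i\<bar>) * (1 + x\<^sup>2) ^ m"
proof -
  have "0 \<le> (\<bar>x\<bar> - 1)\<^sup>2" by simp
  then have "\<bar>x\<bar> \<le> 1 + x\<^sup>2"
    by (simp add: power2_eq_square algebra_simps abs_mult_self_eq)
  then have pow: "\<bar>x\<bar> ^ i \<le> (1 + x\<^sup>2) ^ m" if "i \<le> m" for i
  proof -
    have "\<bar>x\<bar> ^ i \<le> (1 + x\<^sup>2) ^ i" using \<open>\<bar>x\<bar> \<le> _\<close> by (simp add: power_mono)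
    also have "\<dots> \<le> (1 + x\<^sup>2) ^ m" using that by (simp add: power_increasing)
    finally show ?thesis .
  qed
  have "\<bar>poly L x\<bar> \<le> (\<Sum>i\<le>degree L. \<bar>coeff L i * x ^ i\<bar>)"
    unfolding poly_altdef by (rule sum_abs)
  also have "\<dots> \<le> (\<Sum>i\<le>degree L. \<bar>coeff L i\<bar> * (1 + x\<^sup>2) ^ m)"
    using pow assms by (intro sum_mono) (auto simp: abs_mult power_abs intro!: mult_left_mono)
  finally show ?thesis by (simp add: sum_distrib_right)
qed

lemma continuous_on_closed_bounded_away_from_zero:
  fixes f :: "'a::{heine_borel, real_normed_vector} \<Rightarrow> real"
  assumes "closed S" "continuous_on S f" "\<forall>x\<in>S. f x \<noteq> 0"
    and "\<eta> > 0" "\<forall>x. r \<le> norm x \<longrightarrow> \<eta> \<le> \<bar>f x\<bar>"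
  shows "\<exists>\<delta>>0. \<forall>x\<in>S. \<delta> \<le> \<bar>f x\<bar>"
proof (cases "S \<inter> cball 0 r = {}")
  case True
  then have "r \<le> norm x" if "x \<in> S" for x using that by (auto simp: not_le)
  then show ?thesis using assms(4,5) by blast
next
  case False
  have "compact (S \<inter> cball 0 r)" using assms(1) by (simp add: closed_Int_compact)
  moreover have "continuous_on (S \<inter> cball 0 r) (\<lambda>x. \<bar>f x\<bar>)"
    using assms(2) by (intro continuous_intros) (auto intro: continuous_on_subset)
  ultimately obtain x0 where x0: "x0 \<in> S \<inter> cball 0 r" "\<forall>y\<in>S \<inter> cball 0 r. \<bar>f x0\<bar> \<le> \<bar>f y\<bar>"
    using continuous_attains_inf[OF _ False] by blast
  have "\<bar>f x0\<bar> > 0" using x0(1) assms(3) by auto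
  moreover have "min \<eta> \<bar>f x0\<bar> \<le> \<bar>f x\<bar>" if "x \<in> S" for x
    using that x0(2) assms(5) by (cases "r \<le> norm x") (force simp: dist_norm)+
  ultimately show ?thesis using assms(4) by (intro exI[of _ "min \<eta> \<bar>f x0\<bar>"]) auto
qed

lemma abs_poly_bounded_below_at_infinity:
  fixes F :: "real poly"
  assumes "F \<noteq> 0"
  obtains r \<eta> where "\<eta> > 0" "\<forall>x. r \<le> \<bar>x\<bar> \<longrightarrow> \<eta> \<le> \<bar>poly F x\<bar>"
proof (cases "degree F = 0")
  case True
  then obtain c where "F = [:c:]" by (metis degree_eq_zeroE)
  with assms that[of "\<bar>c\<bar>" 0] show ?thesis by auto
next
  case False
  then obtain a F' where "F = pCons a F'" "F' \<noteq> 0" by (metis degree_pCons_0 pCons_cases)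
  with poly_infinity[of F' 1 a] that[of 1] show ?thesis by auto
qed

lemma poly_positive_perturbation:
  fixes F L :: "real poly"
  assumes "F \<noteq> 0" "\<forall>u. poly F u = 0 \<longrightarrow> poly L u > 0" "degree L \<le> m"
  obtains c where "c > 0" "\<forall>x. poly L x + c * (poly F x)\<^sup>2 * (1 + x\<^sup>2) ^ m > 0"
proof -
  define K where "K = (\<Sum>i\<le>degree L. \<bar>coeff L i\<bar>)"
  have "K \<ge> 0" unfolding K_def by (intro sum_nonneg) auto
  obtain r \<eta> where "\<eta> > 0" "\<forall>x. r \<le> \<bar>x\<bar> \<longrightarrow> \<eta> \<le> \<bar>poly F x\<bar>"
    using abs_poly_bounded_below_at_infinity[OF assms(1)] .
  moreover have "closed {x. poly L x \<le> 0}" by (intro closed_Collect_le) (auto intro: continuous_intros)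
  ultimately obtain \<delta> where \<delta>: "\<delta> > 0" "\<forall>x. poly L x \<le> 0 \<longrightarrow> \<delta> \<le> \<bar>poly F x\<bar>"
    using continuous_on_closed_bounded_away_from_zero[of "{x. poly L x \<le> 0}" "poly F" \<eta> r] assms(2)
    by (force intro: continuous_intros)
  define c where "c = K / \<delta>\<^sup>2 + 1"
  have "poly L x + c * (poly F x)\<^sup>2 * (1 + x\<^sup>2) ^ m > 0" for x
  proof (cases "poly L x > 0")
    case True
    have "c * (poly F x)\<^sup>2 * (1 + x\<^sup>2) ^ m \<ge> 0" using \<open>K \<ge> 0\<close> by (simp add: c_def)
    then show ?thesis using True by linarith
  next
    case False
    define W where "W = (1 + x\<^sup>2) ^ m"
    have "W > 0" by (simp add: W_def add_pos_nonneg)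
    have "\<delta>\<^sup>2 \<le> (poly F x)\<^sup>2"
      using \<delta> False by (metis abs_ge_zero less_imp_le not_less power2_abs power_mono)
    have "- poly L x \<le> K * W"
      using abs_poly_le_sum_abs_coeff[OF assms(3), of x] by (simp add: K_def W_def)
    also have "\<dots> = (K / \<delta>\<^sup>2) * \<delta>\<^sup>2 * W" using \<delta>(1) by simp
    also have "\<dots> \<le> (K / \<delta>\<^sup>2) * (poly F x)\<^sup>2 * W"
      using \<open>\<delta>\<^sup>2 \<le> _\<close> \<open>K \<ge> 0\<close> \<open>W > 0\<close> by (intro mult_right_mono mult_left_mono) auto
    also have "\<dots> < c * (poly F x)\<^sup>2 * W"
      using \<open>\<delta>\<^sup>2 \<le> _\<close> \<delta>(1) \<open>W > 0\<close>
      by (intro mult_strict_right_mono) (auto simp: c_def intro: order.strict_trans2)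
    finally show ?thesis by (simp add: W_def)
  qed
  moreover have "c > 0" using \<open>K \<ge> 0\<close> \<delta>(1) by (simp add: c_def add_nonneg_pos)
  ultimately show ?thesis using that by blast
qed

lemma exists_nonvanishing_congruent_pair:
  fixes r L :: "real poly" and s :: real
  assumes "r \<noteq> 0" "s \<noteq> 0" "\<forall>u. poly r u = 0 \<longrightarrow> s * poly L u > 0"
  obtains A B where "\<forall>x. poly A x \<noteq> 0" "\<forall>x. poly B x \<noteq> 0" "degree A = degree B"
    and "r dvd A - L" "r dvd B - 1"
proof -
  define m where "m = Suc (degree L)"
  have "degree (smult s L) \<le> m" by (simp add: m_def)
  then obtain c where "c > 0" and pos: "\<forall>x. s * poly L x + c * (poly r x)\<^sup>2 * (1 + x\<^sup>2) ^ m > 0"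
    using poly_positive_perturbation[of r "smult s L" m] assms(1,3) by auto
  define \<Phi> where "\<Phi> = r * r * [:1, 0, 1:] ^ m"
  define A where "A = L + smult (c / s) \<Phi>"
  define B where "B = 1 + \<Phi>"
  have poly_\<Phi>: "poly \<Phi> x = (poly r x)\<^sup>2 * (1 + x\<^sup>2) ^ m" for x
    by (simp add: \<Phi>_def power2_eq_square)
  have "s * poly A x > 0" for x
    using pos assms(2) by (simp add: A_def poly_\<Phi> algebra_simps)
  moreover have "poly B x > 0" for x
    by (simp add: B_def poly_\<Phi> add_pos_nonneg)
  moreover have "degree \<Phi> = 2 * degree r + 2 * m"
    using assms(1) by (simp add: \<Phi>_def degree_mult_eq degree_power_eq)
  then have "degree L < degree \<Phi>" "0 < degree \<Phi>" by (simp_all add: m_def)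
  then have "degree A = degree B"
    using \<open>c > 0\<close> assms(2) by (simp add: A_def B_def degree_add_eq_left degree_add_eq_right)
  moreover have "A - L = r * (smult (c / s) (r * [:1, 0, 1:] ^ m))" "B - 1 = r * (r * [:1, 0, 1:] ^ m)"
    by (simp_all add: A_def B_def \<Phi>_def mult.assoc mult_smult_right)
  ultimately show ?thesis
    using that by (metis dvd_triv_left less_irrefl mult_zero_right)
qed

lemma correction_in_dressD:
  fixes h k g r fc A B Z :: "real poly"
  assumes k: "\<forall>x. poly k x \<noteq> 0" and B: "\<forall>x. poly B x \<noteq> 0" and fc: "\<forall>x. poly fc x \<noteq> 0"
    and "g \<noteq> 0" "r \<noteq> 0"
    and "degree h \<le> degree k" "degree A = degree B"
    and "degree h + degree g \<le> degree k + degree (r * fc)"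
    and Z: "k * B - h * A = r * Z"
  shows "Fract h k * (1 - Fract h k * Fract A B) / Fract (r * fc) g \<in> dressD"
proof -
  have "k \<noteq> 0" "B \<noteq> 0" "fc \<noteq> 0" using k B fc by auto
  have "Fract h k * (1 - Fract h k * Fract A B) / Fract (r * fc) g
      = Fract (h * Z * g) (k * k * B * fc)"
    using assms(4,5) \<open>k \<noteq> 0\<close> \<open>B \<noteq> 0\<close> \<open>fc \<noteq> 0\<close>
    by (simp add: One_fract_def eq_fract flip: Z) (metis Z mult.commute)
  moreover have "degree (h * Z * g) \<le> degree (k * k * B * fc)"
  proof (cases "Z = 0")
    case False
    have "degree (k * B - h * A) \<le> degree k + degree B"
      using degree_diff_le[of "k * B" _ "h * A"] degree_mult_le[of k B] degree_mult_le[of h A]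
        assms(6,7) by fastforce
    then have "degree r + degree Z \<le> degree k + degree B"
      using False assms(5) by (simp add: Z degree_mult_eq)
    moreover have "degree (h * Z * g) \<le> degree h + degree Z + degree g"
      using degree_mult_le[of "h * Z" g] degree_mult_le[of h Z] by linarith
    ultimately show ?thesis
      using assms(8) \<open>k \<noteq> 0\<close> \<open>B \<noteq> 0\<close> \<open>fc \<noteq> 0\<close> assms(5) by (simp add: degree_mult_eq)
  qed simp
  ultimately show ?thesis using k B fc by (simp add: Fract_in_dressD)
qed

lemma exists_nonvanishing_pair_dvd:
  fixes f h k :: "real poly" and s :: real
  assumes "f \<noteq> 0" "s \<noteq> 0" "\<forall>x. poly k x \<noteq> 0"
    and s: "\<And>u. poly f u = 0 \<Longrightarrow> s * (poly h u / poly k u) > 0"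
  obtains r fc A B where "f = r * fc" "r \<noteq> 0" "\<forall>x. poly fc x \<noteq> 0"
    and "\<forall>x. poly A x \<noteq> 0" "\<forall>x. poly B x \<noteq> 0" "degree A = degree B" "r dvd k * B - h * A"
proof -
  obtain us fc where f_split: "f = (\<Prod>u\<leftarrow>us. [:-u, 1:]) * fc" and fc: "\<forall>x. poly fc x \<noteq> 0"
    using real_poly_split_real_roots[OF \<open>f \<noteq> 0\<close>] .
  define r where "r = (\<Prod>u\<leftarrow>us. [:-u, 1:])"
  have f: "f = r * fc" by (simp add: f_split r_def)
  have "r \<noteq> 0" using \<open>f \<noteq> 0\<close> by (simp add: f)
  have root_r: "poly f u = 0" if "poly r u = 0" for u using that by (simp add: f)
  have "\<forall>u\<in>set us. poly h u \<noteq> 0"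
  proof
    fix u assume "u \<in> set us"
    then have "poly r u = 0" unfolding r_def by (induction us) auto
    then show "poly h u \<noteq> 0" using s[OF root_r] by fastforce
  qed
  then have "coprime h r" unfolding r_def by (rule coprime_linear_factors)
  then obtain L where L: "r dvd k - h * L" by (rule coprime_solve_congruence)
  have "\<forall>u. poly r u = 0 \<longrightarrow> s * poly L u > 0"
  proof (intro allI impI)
    fix u assume "poly r u = 0"
    moreover obtain W where "k - h * L = r * W" using L by (rule dvdE)
    ultimately have "poly (k - h * L) u = 0" by simp
    then have "poly k u = poly h u * poly L u" by simp
    then have "s * poly L u = s * (poly h u / poly k u) * (poly L u)\<^sup>2" "poly L u \<noteq> 0"
      using assms(3) by (auto simp: power2_eq_square)
    then show "s * poly L u > 0"
      using s[OF root_r[OF \<open>poly r u = 0\<close>]] by (metis mult_pos_pos zero_less_power2)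
  qed
  then obtain A B where "\<forall>x. poly A x \<noteq> 0" "\<forall>x. poly B x \<noteq> 0"
    and "degree A = degree B" "r dvd A - L" "r dvd B - 1"
    by (rule exists_nonvanishing_congruent_pair[OF \<open>r \<noteq> 0\<close> \<open>s \<noteq> 0\<close>])
  moreover have "k * B - h * A = k * (B - 1) + (k - h * L) - h * (A - L)" by (simp add: algebra_simps)
  ultimately have "r dvd k * B - h * A" using L by (simp only: dvd_add dvd_diff dvd_mult)
  with that f \<open>r \<noteq> 0\<close> fc \<open>\<forall>x. poly A x \<noteq> 0\<close> \<open>\<forall>x. poly B x \<noteq> 0\<close> \<open>degree A = degree B\<close>
  show ?thesis by blast
qed

lemma exists_dressD_unit_correction:
  fixes p q :: "real poly fract"
  assumes p: "p \<in> dressD" and q: "q \<in> dressD" and "p \<noteq> 0" and "rdeg q \<le> rdeg p"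
    and sign: "(\<forall>u\<in>rroots p. reval q u > 0) \<or> (\<forall>u\<in>rroots p. reval q u < 0)"
  obtains e where "e \<noteq> 0" "e \<in> dressD" "1 / e \<in> dressD" "q * (1 - q * e) / p \<in> dressD"
proof -
  define f g h k where "f = rnum p" and "g = rden p" and "h = rnum q" and "k = rden q"
  note p' = dressD_reduced[OF p, folded f_def g_def]
  note q' = dressD_reduced[OF q, folded h_def k_def]
  have "f \<noteq> 0" "g \<noteq> 0" using \<open>p \<noteq> 0\<close> p' by (auto simp: Zero_fract_def eq_fract)
  obtain s :: real where "s \<noteq> 0" and s: "\<And>u. poly f u = 0 \<Longrightarrow> s * (poly h u / poly k u) > 0"
  proof (cases "\<forall>u\<in>rroots p. reval q u > 0")
    case True
    then show ?thesis using that[of 1] by (simp add: rroots_def reval_def f_def h_def k_def)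
  next
    case False
    then show ?thesis using sign that[of "-1"] by (auto simp: rroots_def reval_def f_def h_def k_def)
  qed
  obtain r fc A B where f: "f = r * fc" and "r \<noteq> 0" and fc: "\<forall>x. poly fc x \<noteq> 0"
    and A: "\<forall>x. poly A x \<noteq> 0" and B: "\<forall>x. poly B x \<noteq> 0" and "degree A = degree B"
    and "r dvd k * B - h * A"
    by (rule exists_nonvanishing_pair_dvd[OF \<open>f \<noteq> 0\<close> \<open>s \<noteq> 0\<close> q'(1) s])
  then obtain Z where Z: "k * B - h * A = r * Z" by (auto elim: dvdE)
  have "degree h + degree g \<le> degree k + degree (r * fc)"
    using \<open>rdeg q \<le> rdeg p\<close>
    unfolding rdeg_def f_def[symmetric] g_def[symmetric] h_def[symmetric] k_def[symmetric] f
    by linarith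
  then have "Fract h k * (1 - Fract h k * Fract A B) / Fract (r * fc) g \<in> dressD"
    by (rule correction_in_dressD[OF q'(1) B fc \<open>g \<noteq> 0\<close> \<open>r \<noteq> 0\<close> q'(2) \<open>degree A = degree B\<close> _ Z])
  moreover have "q * (1 - q * Fract A B) / p
      = Fract h k * (1 - Fract h k * Fract A B) / Fract (r * fc) g"
    using p'(3) q'(3) by (simp add: f)
  moreover have "A \<noteq> 0" "B \<noteq> 0" using A B by auto
  ultimately show ?thesis
    using that[of "Fract A B"] A B \<open>degree A = degree B\<close>
    by (simp add: Zero_fract_def One_fract_def eq_fract Fract_in_dressD)
qed

theorem theorem3p3:
  fixes p q :: "real poly fract"
  assumes "p \<in> dressD" and "q \<in> dressD" and "p \<noteq> 0" and "q \<noteq> 0"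
  and "(rdeg p \<ge> rdeg q \<and> ((\<forall>u\<in>rroots p. reval q u > 0) \<or> (\<forall>u\<in>rroots p. reval q u < 0)))
     \<or> (rdeg q \<ge> rdeg p \<and> ((\<forall>z\<in>rroots q. reval p z > 0) \<or> (\<forall>z\<in>rroots q. reval p z < 0)))"
  shows "prod_idempotents_D (row_mat p q)"
  using assms(5)
proof
  assume "rdeg p \<ge> rdeg q \<and> ((\<forall>u\<in>rroots p. reval q u > 0) \<or> (\<forall>u\<in>rroots p. reval q u < 0))"
  then have "rdeg q \<le> rdeg p" "(\<forall>u\<in>rroots p. reval q u > 0) \<or> (\<forall>u\<in>rroots p. reval q u < 0)"
    by simp_all
  then obtain e where "e \<noteq> 0" "e \<in> dressD" "1 / e \<in> dressD" "q * (1 - q * e) / p \<in> dressD"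
    by (rule exists_dressD_unit_correction[OF assms(1,2,3)])
  then show ?thesis by (rule prod_idempotents_D_row_matI_left[OF assms(1,2,3)])
next
  assume "rdeg q \<ge> rdeg p \<and> ((\<forall>z\<in>rroots q. reval p z > 0) \<or> (\<forall>z\<in>rroots q. reval p z < 0))"
  then have "rdeg p \<le> rdeg q" "(\<forall>z\<in>rroots q. reval p z > 0) \<or> (\<forall>z\<in>rroots q. reval p z < 0)"
    by simp_all
  then obtain e where "e \<noteq> 0" "e \<in> dressD" "1 / e \<in> dressD" "p * (1 - p * e) / q \<in> dressD"
    by (rule exists_dressD_unit_correction[OF assms(2,1,4)])
  then show ?thesis by (rule prod_idempotents_D_row_matI_right[OF assms(1,2,4)])
qed

end
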